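(* Let $a,b\ge2$ be integers and let $e$ be any edge of the complete bipartite graph $K_{a,b}$. Then the characteristic polynomial of the distance Seidel matrix of $K_{a,b}-e$ is $$\det\big(xI-\mathcal{D}^S(K_{a,b}-e)\big)=(x-3)^{a+b-4}\Big(x^4-(12-3a-3b)x^3-(-30+27a+27b-8ab)x^2-(-132-33a-33b+48ab)x-(551-191a-191b+56ab)\Big).$$
   Context: For a connected graph $G$ with distance matrix $\mathcal{D}(G)$, the distance Seidel matrix is $\mathcal{D}^S(G)=J-I-2\mathcal{D}(G)$, $J$ the all-ones matrix. $K_{a,b}-e$ denotes the graph obtained from $K_{a,b}$ by deleting the edge $e$. *)

theory Defs
  imports "Graph_Theory.Graph_Theory" "Jordan_Normal_Form.Char_Poly"
begin

text \<open>
  Finite simple graphs are symmetric loop-free pair digraphs: an undirected edge \<open>uv\<close> is the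
  pair of arcs \<open>(u, v)\<close>, \<open>(v, u)\<close>, so deleting the edge removes both arcs.
\<close>

definition del_edge :: "'a pair_pre_digraph \<Rightarrow> 'a \<Rightarrow> 'a \<Rightarrow> 'a pair_pre_digraph" where
  "del_edge G u v = \<lparr> pverts = pverts G, parcs = parcs G - {(u, v), (v, u)} \<rparr>"

text \<open>
  The distance is the least number of arcs of a walk. It is infinite when there is no walk,
  and then \<^const>\<open>real_of_ereal\<close> returns \<open>0\<close>; so the definition is meaningful for
  connected graphs only.
\<close>

definition gdist :: "'a pair_pre_digraph \<Rightarrow> 'a \<Rightarrow> 'a \<Rightarrow> real" where
  "gdist G u v = real_of_ereal (wf_digraph.\<mu> (with_proj G) (\<lambda>_. 1) u v)"

text \<open>
  The list \<open>vs\<close> enumerates the vertices without repetition and fixes the order of the rows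
  and columns.
\<close>

definition distance_matrix :: "'a pair_pre_digraph \<Rightarrow> 'a list \<Rightarrow> real mat" where
  "distance_matrix G vs = mat (length vs) (length vs) (\<lambda>(i, j). gdist G (vs ! i) (vs ! j))"

definition distance_seidel_matrix :: "'a pair_pre_digraph \<Rightarrow> 'a list \<Rightarrow> real mat" where
  "distance_seidel_matrix G vs =
     mat (length vs) (length vs) (\<lambda>_. 1) - 1\<^sub>m (length vs) - 2 \<cdot>\<^sub>m distance_matrix G vs"

text \<open>
  The graph \<open>K\<^bsub>a,b\<^esub> - e\<close> is connected for \<open>a, b \<ge> 2\<close>, hence all its distances are finite.
\<close>

lemma pair_graph_del_edge:
  assumes "K\<^bsub>a,b\<^esub> (with_proj G)"
  shows "pair_graph (del_edge G u v)"
proof -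
  have "pair_graph G"
    using assms by (intro pair_graphI_graph) (simp add: complete_bipartite_digraph_def)
  then interpret pair_graph G .
  have s: "(y, x) \<in> parcs G" if "(x, y) \<in> parcs G" for x y
    using that arcs_symmetric by blast
  show ?thesis
    by unfold_locales
      (auto simp: del_edge_def symmetric_def sym_def pair_finite_verts pair_finite_arcs
        dest: s in_arcsD1 in_arcsD2 no_loops')
qed

lemma connected_K_del_edge:
  assumes "2 \<le> a" "2 \<le> b" "K\<^bsub>a,b\<^esub> (with_proj G)" "(u, v) \<in> parcs G"
  shows "connected (with_proj (del_edge G u v))"
proof -
  let ?H = "del_edge G u v"
  interpret H: pair_graph ?H using pair_graph_del_edge[OF assms(3)] .
  obtain U V where UV: "pverts G = U \<union> V" "U \<inter> V = {}" "parcs G = U \<times> V \<union> V \<times> U"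
      and cU: "2 \<le> card U" and cV: "2 \<le> card V" and uv: "u \<in> U" "v \<in> V"
  proof -
    obtain U V where *: "pverts G = U \<union> V" "U \<inter> V = {}" "card U = a" "card V = b"
        "parcs G = U \<times> V \<union> V \<times> U"
      using assms(3) unfolding complete_bipartite_digraph_pair_def by blast
    show thesis
    proof (cases "u \<in> U")
      case True
      then show thesis using that[of U V] * assms by auto
    next
      case False
      then show thesis using that[of V U] * assms by auto
    qed
  qed
  have "\<not> U \<subseteq> {u}" "\<not> V \<subseteq> {v}"
    using cU cV card_mono[of "{u}" U] card_mono[of "{v}" V] by auto
  then obtain u' v' where u': "u' \<in> U" "u' \<noteq> u" and v': "v' \<in> V" "v' \<noteq> v" by blast
  have ne: "u \<noteq> v'" "u' \<noteq> v" "u \<noteq> v" using UV(2) uv u' v' by auto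
  have arcV: "(u', w) \<in> parcs ?H" if "w \<in> V" for w
    using that UV u' ne by (auto simp: del_edge_def)
  have arcU: "(v', w) \<in> parcs ?H" if "w \<in> U" for w
    using that UV v' ne by (auto simp: del_edge_def)
  have from_u': "u' \<rightarrow>\<^sup>*\<^bsub>with_proj ?H\<^esub> w" if "w \<in> pverts ?H" for w
  proof (cases "w \<in> V")
    case True
    then show ?thesis using arcV H.reachable_adjI by simp
  next
    case False
    then have "w \<in> U" using that UV by (simp add: del_edge_def)
    then have "v' \<rightarrow>\<^sup>*\<^bsub>with_proj ?H\<^esub> w" using arcU H.reachable_adjI by simp
    moreover have "u' \<rightarrow>\<^sup>*\<^bsub>with_proj ?H\<^esub> v'" using arcV v' H.reachable_adjI by simp
    ultimately show ?thesis using H.reachable_trans by blast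
  qed
  have sym: "symmetric (with_proj ?H)" by (rule H.sym_arcs)
  have "x \<rightarrow>\<^sup>*\<^bsub>with_proj ?H\<^esub> y" if "x \<in> pverts ?H" "y \<in> pverts ?H" for x y
    using from_u'[OF that(1)] from_u'[OF that(2)] symmetric_reachable[OF sym]
      H.reachable_trans by blast
  moreover have "pverts ?H \<noteq> {}" using UV uv by (auto simp: del_edge_def)
  ultimately have "strongly_connected (with_proj ?H)"
    by (auto simp: strongly_connected_def)
  moreover have "mk_symmetric (with_proj ?H) = ?H"
    using H.arcs_symmetric by (fastforce simp: mk_symmetric_def intro: pair_pre_digraph.equality)
  ultimately show ?thesis by (simp add: connected_def)
qed

end

theory Submission
  imports Defs
begin

text \<open>
  Let \<open>x\<close> be the indeterminate and \<open>D\<close> the distance Seidel matrix. The distances in the graph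
  depend only on the classes of their endpoints in the partition of the vertices into \<open>{u}\<close>,
  \<open>{v}\<close> and the two remainders of the parts, except that a vertex is at distance \<open>0\<close> and not
  \<open>2\<close> from itself; hence \<open>x I - D = (x - 3) I + W Q W\<^sup>T\<close>, where \<open>W\<close> is the class indicator
  matrix and \<open>Q\<close> is a \<open>4 \<times> 4\<close> matrix of constants. Sylvester's identity moves \<open>W\<close> across, and
  since \<open>W\<^sup>T W\<close> is the diagonal matrix of class sizes only a \<open>4 \<times> 4\<close> determinant remains.
\<close>

section \<open>Distances\<close>

text \<open>With unit arc costs the infimum in \<open>gdist\<close> is attained at a shortest walk;
  its value is then finite, so \<open>real_of_ereal\<close> returns it unchanged.\<close>

lemma gdist_eq_length:
  assumes "wf_digraph (with_proj G)"
    and p: "pre_digraph.awalk (with_proj G) x p y"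
    and min: "\<And>q. pre_digraph.awalk (with_proj G) x q y \<Longrightarrow> length p \<le> length q"
  shows "gdist G x y = length p"
proof -
  interpret wf_digraph "with_proj G" by fact
  have cost: "awalk_cost (\<lambda>_. 1) q = length q" for q :: "('a \<times> 'a) awalk"
    by (induction q) auto
  have "\<mu> (\<lambda>_. 1) x y = ereal (length p)"
    unfolding \<mu>_def cost
    using p min by (intro antisym INF_lower2[where i = p] INF_greatest) auto
  then show ?thesis by (simp add: gdist_def)
qed

text \<open>Every arc changes sides, which fixes the parity of a walk by its ends. Only the edge
  between \<open>u\<close> and \<open>v\<close> is missing, so \<open>v'\<close> is adjacent to all
  of \<open>U\<close> and \<open>u'\<close> to all of \<open>V\<close>. They serve as common
  neighbours on each side, and \<open>u\<close>, \<open>v'\<close>, \<open>u'\<close>,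
  \<open>v\<close> is a detour of length 3.\<close>

lemma gdist_bipartite_del_edge:
  assumes wf: "wf_digraph (with_proj H)"
    and verts: "pverts H = U \<union> V" and disj: "U \<inter> V = {}"
    and arcs: "parcs H = U \<times> V \<union> V \<times> U - {(u, v), (v, u)}"
    and uv: "u \<in> U" "v \<in> V"
    and u': "u' \<in> U" "u' \<noteq> u" and v': "v' \<in> V" "v' \<noteq> v"
    and xy: "x \<in> U \<union> V" "y \<in> U \<union> V"
  shows "gdist H x y =
    (if x = y then 0 else if x \<in> U \<longleftrightarrow> y \<in> U then 2
     else if x = u \<and> y = v \<or> x = v \<and> y = u then 3 else 1)"
proof -
  interpret wf_digraph "with_proj H" by (rule wf)
  have ne: "s \<noteq> t" if "s \<in> U" "t \<in> V" for s t
    using that disj by auto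
  have arc: "(s, t) \<in> parcs H \<longleftrightarrow>
      (s \<in> U \<and> t \<in> V \<or> s \<in> V \<and> t \<in> U) \<and> \<not> (s = u \<and> t = v) \<and> \<not> (s = v \<and> t = u)" for s t
    by (auto simp: arcs)
  have walk0: "awalk s [] t \<longleftrightarrow> s = t \<and> s \<in> U \<union> V" for s t
    by (auto simp: awalk_Nil_iff verts)
  have walkS: "awalk s (e # es) t \<longleftrightarrow> (\<exists>w. e = (s, w) \<and> (s, w) \<in> parcs H \<and> awalk w es t)" for s e es t
    by (cases e) (auto simp: awalk_Cons_iff)
  have not0: "length q \<ge> 1" if "awalk x q y" "x \<noteq> y" for q
    using that by (cases q) (auto simp: walk0)
  have not1: "length q \<ge> 2" if "awalk x q y" "x \<noteq> y" "(x, y) \<notin> parcs H" for q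
  proof (rule ccontr)
    assume "\<not> length q \<ge> 2"
    then have "length q = 1" using not0[OF that(1,2)] by simp
    then obtain e where "q = [e]" by (auto simp: length_Suc_conv)
    then show False using that by (auto simp: walk0 walkS)
  qed
  have dist: "gdist H x y = real d"
    if "awalk x p y" "length p = d" "\<And>q. awalk x q y \<Longrightarrow> d \<le> length q" for p d
    using gdist_eq_length[OF wf, of x p y] that by auto
  \<comment> \<open>Each case carries the inner vertices of a walk that attains the claimed
    distance.\<close>
  consider (eq) "x = y"
    | (same) m where "x \<noteq> y" "x \<in> U \<longleftrightarrow> y \<in> U" "(x, m) \<in> parcs H" "(m, y) \<in> parcs H"
    | (edge) "x \<noteq> y" "\<not> (x \<in> U \<longleftrightarrow> y \<in> U)" "\<not> (x = u \<and> y = v \<or> x = v \<and> y = u)"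
    | (deleted) m n where "\<not> (x \<in> U \<longleftrightarrow> y \<in> U)" "x = u \<and> y = v \<or> x = v \<and> y = u"
        "(x, m) \<in> parcs H" "(m, n) \<in> parcs H" "(n, y) \<in> parcs H"
  proof -
    have "\<exists>m. (x, m) \<in> parcs H \<and> (m, y) \<in> parcs H" if "x \<in> U \<longleftrightarrow> y \<in> U"
    proof (cases "x \<in> U")
      case True
      then show ?thesis using that v' uv ne by (intro exI[of _ v']) (auto simp: arc)
    next
      case False
      then show ?thesis using that xy u' uv ne by (intro exI[of _ u']) (auto simp: arc)
    qed
    moreover have "\<exists>m n. (x, m) \<in> parcs H \<and> (m, n) \<in> parcs H \<and> (n, y) \<in> parcs H"
      if "x = u \<and> y = v \<or> x = v \<and> y = u"
      using that
    proof
      assume "x = u \<and> y = v"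
      then show ?thesis using u' v' uv ne by (intro exI[of _ v'] exI[of _ u']) (auto simp: arc)
    next
      assume "x = v \<and> y = u"
      then show ?thesis using u' v' uv ne by (intro exI[of _ u'] exI[of _ v']) (auto simp: arc)
    qed
    ultimately show thesis using that by blast
  qed
  then show ?thesis
  proof cases
    case eq
    then show ?thesis using dist[of "[]" 0] xy by (simp add: walk0)
  next
    case (same m)
    have "awalk x [(x, m), (m, y)] y" using same(3,4) xy by (simp add: walk0 walkS)
    moreover have "(x, y) \<notin> parcs H" using same(2) disj by (auto simp: arc)
    ultimately show ?thesis using dist[of "[(x, m), (m, y)]" 2] not1 same(1,2) by auto
  next
    case edge
    have "awalk x [(x, y)] y" using edge xy by (auto simp: walk0 walkS arc)
    then show ?thesis using dist[of "[(x, y)]" 1] not0 edge by auto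
  next
    case (deleted m n)
    have "x \<noteq> y" using deleted(1) by auto
    have "awalk x [(x, m), (m, n), (n, y)] y" using deleted(3-5) xy by (simp add: walk0 walkS)
    moreover have "3 \<le> length q" if walk: "awalk x q y" for q
    proof (rule ccontr)
      assume "\<not> 3 \<le> length q"
      moreover have "2 \<le> length q"
        using not1[OF that \<open>x \<noteq> y\<close>] deleted(2) by (auto simp: arc)
      ultimately have "length q = 2" by simp
      then obtain e f where "q = [e, f]"
        by (auto simp: numeral_2_eq_2 length_Suc_conv)
      then have "\<exists>w. (x, w) \<in> parcs H \<and> (w, y) \<in> parcs H"
        using walk by (auto simp: walk0 walkS)
      \<comment> \<open>A common neighbour \<open>w\<close> would put \<open>x\<close> and
        \<open>y\<close> on the same side.\<close>
      then show False using deleted(1) disj by (auto simp: arc)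
    qed
    ultimately show ?thesis using dist[of "[(x, m), (m, n), (n, y)]" 3] deleted(1,2) \<open>x \<noteq> y\<close> by auto
  qed
qed

section \<open>Determinants of block-constant matrices\<close>

text \<open>
  Keeping the powers of \<open>y\<close> on both sides avoids dividing by \<open>y\<close>, so the identity applies over
  a polynomial ring.
\<close>

lemma det_smult_one_add_mult_swap:
  fixes B C :: "'a :: idom mat"
  assumes B: "B \<in> carrier_mat n m" and C: "C \<in> carrier_mat m n"
  shows "y ^ m * det (y \<cdot>\<^sub>m 1\<^sub>m n + B * C) = y ^ n * det (y \<cdot>\<^sub>m 1\<^sub>m m + C * B)"
proof -
  \<comment> \<open>Block elimination of \<open>?P\<close> from the right by \<open>?R\<close> and
    from the left by \<open>?L\<close> gives two block upper triangular products. Comparing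
    determinants eliminates \<open>det ?P\<close>. The block \<open>y\<close> in \<open>?L\<close>
    replaces a division by \<open>y\<close>.\<close>
  let ?P = "four_block_mat (y \<cdot>\<^sub>m 1\<^sub>m n) (- B) C (1\<^sub>m m)"
  let ?R = "four_block_mat (1\<^sub>m n) (0\<^sub>m n m) (- C) (1\<^sub>m m)"
  let ?L = "four_block_mat (1\<^sub>m n) (0\<^sub>m n m) (- C) (y \<cdot>\<^sub>m 1\<^sub>m m)"
  have carr: "?P \<in> carrier_mat (n + m) (n + m)" "?R \<in> carrier_mat (n + m) (n + m)"
      "?L \<in> carrier_mat (n + m) (n + m)"
    using B C by auto
  have "?P * ?R = four_block_mat (y \<cdot>\<^sub>m 1\<^sub>m n + B * C) (- B) (0\<^sub>m m n) (1\<^sub>m m)"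
    using B C by (subst mult_four_block_mat[of _ n n _ m _ m _ _ n _ m])
      (auto intro!: arg_cong4[of _ _ _ _ _ _ _ _ four_block_mat])
  then have "det ?P * det ?R = det (y \<cdot>\<^sub>m 1\<^sub>m n + B * C)"
    using B C by (simp add: det_mult[OF carr(1,2), symmetric] det_four_block_mat_lower_left_zero[of _ n _ m])
  moreover have "det ?R = 1"
    using C by (simp add: det_four_block_mat_upper_right_zero[of _ n _ m])
  moreover have "?L * ?P = four_block_mat (y \<cdot>\<^sub>m 1\<^sub>m n) (- B) (0\<^sub>m m n) (y \<cdot>\<^sub>m 1\<^sub>m m + C * B)"
    using B C by (subst mult_four_block_mat[of _ n n _ m _ m _ _ n _ m])
      (auto intro!: arg_cong4[of _ _ _ _ _ _ _ _ four_block_mat])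
  then have "det ?L * det ?P = y ^ n * det (y \<cdot>\<^sub>m 1\<^sub>m m + C * B)"
    using B C by (simp add: det_mult[OF carr(3,1), symmetric] det_four_block_mat_lower_left_zero[of _ n _ m])
  moreover have "det ?L = y ^ m"
    using C by (simp add: det_four_block_mat_upper_right_zero[of _ n _ m])
  ultimately show ?thesis by simp
qed

lemma det_block_constant:
  fixes q :: "nat \<Rightarrow> nat \<Rightarrow> 'a :: idom"
  assumes cls: "\<And>i. i < n \<Longrightarrow> cls i < m"
  shows "y ^ m * det (mat n n (\<lambda>(i, j). (if i = j then y else 0) + q (cls i) (cls j))) =
    y ^ n * det (mat m m (\<lambda>(k, l). (if k = l then y else 0) + of_nat (card {j. j < n \<and> cls j = k}) * q k l))"
proof -
  \<comment> \<open>In terms of the indicator matrix \<open>W\<close>, these are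
    \<open>B = W Q\<close> and \<open>C = W^T\<close>. Row \<open>i\<close> of \<open>B * C\<close>
    picks out \<open>q (cls i) (cls j)\<close> at column \<open>j\<close>, while
    \<open>C * B\<close> sums over a class and so produces its size.\<close>
  define B where "B = mat n m (\<lambda>(i, l). q (cls i) l)"
  define C :: "'a mat" where "C = mat m n (\<lambda>(k, j). if cls j = k then 1 else 0)"
  have carr: "B \<in> carrier_mat n m" "C \<in> carrier_mat m n"
    by (auto simp: B_def C_def)
  have "y \<cdot>\<^sub>m 1\<^sub>m n + B * C = mat n n (\<lambda>(i, j). (if i = j then y else 0) + q (cls i) (cls j))"
    using cls by (intro eq_matI) (auto simp: B_def C_def scalar_prod_def if_distrib cong: if_cong)
  moreover have "(\<Sum>j = 0..<n. (if cls j = k then 1 else 0) * q (cls j) l) =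
      of_nat (card {j. j < n \<and> cls j = k}) * q k l" for k l
  proof -
    have "(\<Sum>j = 0..<n. (if cls j = k then 1 else 0) * q (cls j) l) =
        (\<Sum>j | j < n \<and> cls j = k. q k l)"
      by (intro sum.mono_neutral_cong_right) auto
    then show ?thesis by simp
  qed
  then have "y \<cdot>\<^sub>m 1\<^sub>m m + C * B = mat m m (\<lambda>(k, l). (if k = l then y else 0) +
      of_nat (card {j. j < n \<and> cls j = k}) * q k l)"
    by (intro eq_matI) (auto simp: B_def C_def scalar_prod_def)
  ultimately show ?thesis
    using det_smult_one_add_mult_swap[OF carr, of y] by simp
qed

text \<open>Laplace expansion along the first row, with the minors again written as
  \<open>mat\<close> of a function so that it can be iterated. The conditional index skips column
  \<open>j\<close>.\<close>

lemma det_mat_Suc: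
  fixes f :: "nat \<times> nat \<Rightarrow> 'a :: comm_ring_1"
  shows "det (mat (Suc n) (Suc n) f) =
    (\<Sum>j<Suc n. (- 1) ^ j * f (0, j) * det (mat n n (\<lambda>(k, l). f (Suc k, if l < j then l else Suc l))))"
proof -
  have "mat_delete (mat (Suc n) (Suc n) f) 0 j =
      mat n n (\<lambda>(k, l). f (Suc k, if l < j then l else Suc l))" for j
    by (auto simp: mat_delete_def intro!: eq_matI)
  then show ?thesis
    by (subst laplace_expansion_row[of _ "Suc n" 0]) (auto simp: cofactor_def mult_ac intro!: sum.cong)
qed

lemma det_mat_2:
  fixes f :: "nat \<times> nat \<Rightarrow> 'a :: comm_ring_1"
  shows "det (mat 2 2 f) = f (0, 0) * f (1, 1) - f (0, 1) * f (1, 0)"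
proof -
  have "det (mat (Suc 0) (Suc 0) g) = g (0, 0)" for g :: "nat \<times> nat \<Rightarrow> 'a"
    by (simp add: det_mat_Suc det_dim_zero[OF mat_carrier])
  moreover have "{..<2 :: nat} = {0, 1}" by auto
  ultimately show ?thesis
    using det_mat_Suc[of 1 f] by (simp flip: numeral_2_eq_2)
qed

lemma det_mat_3:
  fixes f :: "nat \<times> nat \<Rightarrow> 'a :: comm_ring_1"
  shows "det (mat 3 3 f) =
    f (0, 0) * (f (1, 1) * f (2, 2) - f (1, 2) * f (2, 1)) -
    f (0, 1) * (f (1, 0) * f (2, 2) - f (1, 2) * f (2, 0)) +
    f (0, 2) * (f (1, 0) * f (2, 1) - f (1, 1) * f (2, 0))"
proof -
  have "{..<3 :: nat} = {0, 1, 2}" by auto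
  then show ?thesis
    using det_mat_Suc[of 2 f] by (simp add: det_mat_2 flip: numeral_2_eq_2)
qed

section \<open>The characteristic polynomial\<close>

text \<open>The classes are ordered \<open>{u}\<close>, \<open>{v}\<close>, \<open>U - {u}\<close>,
  \<open>V - {v}\<close>, with sizes \<open>1, 1, a - 1, b - 1\<close>. Distances 1, 2, 3 contribute
  \<open>2 d - 1\<close>, that is 1, 3, 5. A general commutative ring allows \<open>x\<close> to be
  the polynomial indeterminate.\<close>

lemma det_quotient_matrix:
  fixes x a b :: "'a :: comm_ring_1"
  shows "det (mat 4 4 (\<lambda>(k, l). (if k = l then x - 3 else 0) + [1, 1, a - 1, b - 1] ! k *
      [[3, 5, 3, 1], [5, 3, 1, 3], [3, 1, 3, 1], [1, 3, 1, 3]] ! k ! l)) =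
    x ^ 4 - (12 - 3 * a - 3 * b) * x ^ 3 - (- 30 + 27 * a + 27 * b - 8 * a * b) * x ^ 2
      - (- 132 - 33 * a - 33 * b + 48 * a * b) * x - (551 - 191 * a - 191 * b + 56 * a * b)"
    (is "det (mat 4 4 ?f) = ?rhs")
proof -
  let ?minor = "\<lambda>j. mat 3 3 (\<lambda>(k, l). ?f (Suc k, if l < j then l else Suc l))"
  have "{..<4 :: nat} = {0, 1, 2, 3}" by auto
  then have "det (mat 4 4 ?f) = (\<Sum>j\<in>{0, 1, 2, 3}. (- 1) ^ j * ?f (0, j) * det (?minor j))"
    using det_mat_Suc[of 3 ?f] by simp
  also have "\<dots> = ?rhs"
    by (simp add: det_mat_3 flip: numeral_2_eq_2) (simp add: algebra_simps power_numeral_reduce)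
  finally show ?thesis .
qed

lemma char_poly_matrix_conv_mat:
  assumes "A \<in> carrier_mat n n"
  shows "char_poly_matrix A = mat n n (\<lambda>(i, j). (if i = j then [:0, 1:] else 0) + [:- (A $$ (i, j)):])"
  using assms by (intro eq_matI) (auto simp: char_poly_matrix_def)

theorem theorem5p1:
  fixes a b :: nat and G :: "'a pair_pre_digraph" and u v :: 'a and vs :: "'a list"
  assumes "2 \<le> a" and "2 \<le> b"
    and "K\<^bsub>a,b\<^esub> (with_proj G)"
    and "(u, v) \<in> parcs G"
    and "distinct vs" and "set vs = pverts (del_edge G u v)"
  shows "char_poly (distance_seidel_matrix (del_edge G u v) vs) =
    [:-3, 1:] ^ (a + b - 4) *
    [: - (551 - 191 * real a - 191 * real b + 56 * real a * real b),
       - (-132 - 33 * real a - 33 * real b + 48 * real a * real b),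
       - (-30 + 27 * real a + 27 * real b - 8 * real a * real b),
       - (12 - 3 * real a - 3 * real b),
       1 :]"
proof -
  let ?H = "del_edge G u v"
  interpret H: pair_graph ?H by (rule pair_graph_del_edge[OF assms(3)])
  \<comment> \<open>The part containing \<open>u\<close> may be the one of size \<open>a\<close> or
    the one of size \<open>b\<close>; naming it \<open>U\<close> leaves the sizes known only up to a
    swap.\<close>
  obtain U V a' b' where UV: "pverts G = U \<union> V" "U \<inter> V = {}" "parcs G = U \<times> V \<union> V \<times> U"
      and ab': "card U = a'" "card V = b'" "a' = a \<and> b' = b \<or> a' = b \<and> b' = a"
      and uv: "u \<in> U" "v \<in> V"
  proof -
    obtain U V where *: "pverts G = U \<union> V" "U \<inter> V = {}" "card U = a" "card V = b"
        "parcs G = U \<times> V \<union> V \<times> U"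
      using assms(3) unfolding complete_bipartite_digraph_pair_def by blast
    show thesis
    proof (cases "u \<in> U")
      case True
      then show thesis using that[of U V] * assms(4) by auto
    next
      case False
      then show thesis using that[of V U] * assms(4) by auto
    qed
  qed
  have ge2: "2 \<le> a'" "2 \<le> b'" using ab' assms(1,2) by auto
  have fin: "finite U" "finite V" using ge2 ab' by (auto intro: card_ge_0_finite)
  have verts: "pverts ?H = U \<union> V"
    by (simp add: del_edge_def UV)
  have arcs: "parcs ?H = U \<times> V \<union> V \<times> U - {(u, v), (v, u)}"
    by (simp add: del_edge_def UV)
  have vs: "set vs = U \<union> V" using assms(6) verts by simp
  have "\<not> U \<subseteq> {u}" "\<not> V \<subseteq> {v}"
    using ge2 ab' card_mono[of "{u}" U] card_mono[of "{v}" V] by auto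
  then obtain u' v' where u': "u' \<in> U" "u' \<noteq> u" and v': "v' \<in> V" "v' \<noteq> v" by blast
  note dist = gdist_bipartite_del_edge[OF H.wf_digraph_axioms verts UV(2) arcs uv u' v']

  define n where "n = length vs"
  have n: "n = a + b"
    using distinct_card[OF assms(5)] vs card_Un_disjoint[OF fin UV(2)] ab' by (auto simp: n_def)
  define c :: "'a \<Rightarrow> nat"
    where "c w = (if w = u then 0 else if w = v then 1 else if w \<in> U then 2 else 3)" for w
  have c4: "c (vs ! i) < 4" if "i < n" for i by (simp add: c_def)
  define q :: "nat \<Rightarrow> nat \<Rightarrow> real poly" where
    "q k l = [[3, 5, 3, 1], [5, 3, 1, 3], [3, 1, 3, 1], [1, 3, 1, 3]] ! k ! l" for k l
  let ?x = "[:0, 1:] :: real poly"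
  have card_class: "of_nat (card {j. j < n \<and> c (vs ! j) = k}) =
      [1, 1, of_nat a' - 1, of_nat b' - 1 :: real poly] ! k" if "k < 4" for k
  proof -
    have "{w \<in> set vs. c w = 0} = {u}" "{w \<in> set vs. c w = 1} = {v}"
        "{w \<in> set vs. c w = 2} = U - {u}" "{w \<in> set vs. c w = 3} = V - {v}"
      using uv UV(2) vs by (auto simp: c_def)
    \<comment> \<open>As \<open>vs\<close> is distinct, indexing is a bijection from positions to
      vertices.\<close>
    moreover have "card {j. j < n \<and> c (vs ! j) = k} = card {w \<in> set vs. c w = k}"
    proof (rule bij_betw_same_card)
      show "bij_betw ((!) vs) {j. j < n \<and> c (vs ! j) = k} {w \<in> set vs. c w = k}"
        using bij_betw_nth[OF assms(5) refl refl]
        by (auto simp: bij_betw_def n_def in_set_conv_nth inj_on_def)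
    qed
    moreover have "k = 0 \<or> k = 1 \<or> k = 2 \<or> k = 3" using that by auto
    ultimately show ?thesis
      using uv ab' ge2 fin by (auto simp: of_nat_diff)
  qed
  let ?A = "distance_seidel_matrix ?H vs"
  have carr: "?A \<in> carrier_mat n n"
    by (auto simp: distance_seidel_matrix_def distance_matrix_def n_def)
  \<comment> \<open>Off the diagonal the entry is \<open>2 d - 1\<close>. On the diagonal it is
    \<open>?x\<close>, split as \<open>(?x - 3) + 3\<close> because \<open>q\<close> treats equal
    vertices like distinct ones of the same class, at distance 2.\<close>
  have "(if i = j then ?x else 0) + [:- (?A $$ (i, j)):] =
      (if i = j then ?x - 3 else 0) + q (c (vs ! i)) (c (vs ! j))" if ij: "i < n" "j < n" for i j
  proof -
    have w: "vs ! i \<in> U \<union> V" "vs ! j \<in> U \<union> V"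
      using ij vs nth_mem by (auto simp: n_def)
    have "i = j \<longleftrightarrow> vs ! i = vs ! j"
      using ij assms(5) by (simp add: nth_eq_iff_index_eq n_def)
    moreover have "?A $$ (i, j) = 1 - (if i = j then 1 else 0) - 2 * gdist ?H (vs ! i) (vs ! j)"
      using ij by (simp add: distance_seidel_matrix_def distance_matrix_def n_def)
    ultimately show ?thesis
      using w uv UV(2) dist[OF w]
      by (auto simp: q_def c_def numeral_poly one_pCons)
  qed
  then have "char_poly_matrix ?A =
      mat n n (\<lambda>(i, j). (if i = j then ?x - 3 else 0) + q (c (vs ! i)) (c (vs ! j)))"
    unfolding char_poly_matrix_conv_mat[OF carr] by (intro cong_mat) auto
  then have "(?x - 3) ^ 4 * char_poly ?A = (?x - 3) ^ n * det (mat 4 4 (\<lambda>(k, l).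
      (if k = l then ?x - 3 else 0) + of_nat (card {j. j < n \<and> c (vs ! j) = k}) * q k l))"
    unfolding char_poly_def
    using det_block_constant[of n "\<lambda>i. c (vs ! i)" 4 "?x - 3" q, OF c4] by metis
  also have "mat 4 4 (\<lambda>(k, l).
      (if k = l then ?x - 3 else 0) + of_nat (card {j. j < n \<and> c (vs ! j) = k}) * q k l) =
    mat 4 4 (\<lambda>(k, l). (if k = l then ?x - 3 else 0) + [1, 1, of_nat a' - 1, of_nat b' - 1] ! k * q k l)"
    by (intro cong_mat refl) (auto simp: card_class)
  also have "det \<dots> = [: - (551 - 191 * real a - 191 * real b + 56 * real a * real b),
       - (-132 - 33 * real a - 33 * real b + 48 * real a * real b),
       - (-30 + 27 * real a + 27 * real b - 8 * real a * real b),
       - (12 - 3 * real a - 3 * real b), 1 :]" (is "_ = ?p")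
    \<comment> \<open>The determinant is symmetric in the two part sizes, so the possible swap of
      \<open>a\<close> and \<open>b\<close> is harmless.\<close>
    unfolding q_def det_quotient_matrix using ab'(3)
    by (auto simp: of_nat_poly numeral_poly power_numeral_reduce)
  \<comment> \<open>Here \<open>a + b\<close> is at least 4, so the natural subtraction is exact;
    the nonzero factor \<open>(?x - 3) ^ 4\<close> can then be cancelled.\<close>
  also have "(?x - 3) ^ n = (?x - 3) ^ 4 * (?x - 3) ^ (a + b - 4)"
    using assms(1,2) by (simp add: n flip: power_add)
  finally have "(?x - 3) ^ 4 * char_poly ?A = (?x - 3) ^ 4 * ((?x - 3) ^ (a + b - 4) * ?p)"
    by (simp only: mult.assoc)
  moreover have "?x - 3 = [:-3, 1:]" by (simp add: numeral_poly)
  ultimately show ?thesis by simp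
qed

end
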